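(* Let $\alpha\in\mathbb{C}$ and $K_5=\dfrac{q^2p^2+\alpha qp-q}{2t}$. The system $$\frac{dq}{dt}=\frac{\partial K_5}{\partial p},\qquad \frac{dp}{dt}=-\frac{\partial K_5}{\partial q}$$ has the first integral $I_5=q^2p^2+\alpha qp-q$.
   Context: A first integral is a function of $(q,p)$ that is constant along every solution of the system. *)

theory Defs
  imports "HOL-Analysis.Analysis"
begin

text \<open>
  A time-dependent Hamiltonian is a function \<open>H q p t\<close>. Only times in \<open>T\<close>, the set where
  \<open>H\<close> is regular in \<open>t\<close>, are admitted (division by zero is total in HOL, so the singular
  time has to be excluded explicitly). A solution is a pair of single-valued functions that are
  complex differentiable on a domain (open connected set) \<open>D \<subseteq> T\<close>; every domain is allowed,
  so local solutions and branches of multivalued solutions are covered.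
\<close>

definition hamiltonian_solution ::
  "(complex \<Rightarrow> complex \<Rightarrow> complex \<Rightarrow> complex) \<Rightarrow> complex set \<Rightarrow> complex set \<Rightarrow>
   (complex \<Rightarrow> complex) \<Rightarrow> (complex \<Rightarrow> complex) \<Rightarrow> bool" where
  "hamiltonian_solution H T D q p \<longleftrightarrow>
     open D \<and> connected D \<and> D \<subseteq> T \<and>
     (\<forall>t\<in>D. (q has_field_derivative deriv (\<lambda>y. H (q t) y t) (p t)) (at t) \<and>
            (p has_field_derivative - deriv (\<lambda>x. H x (p t) t) (q t)) (at t))"

definition first_integral ::
  "(complex \<Rightarrow> complex \<Rightarrow> complex \<Rightarrow> complex) \<Rightarrow> complex set \<Rightarrow>
   (complex \<Rightarrow> complex \<Rightarrow> complex) \<Rightarrow> bool" where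
  "first_integral H T I \<longleftrightarrow>
     (\<forall>D q p. hamiltonian_solution H T D q p \<longrightarrow> (\<lambda>t. I (q t) (p t)) constant_on D)"

definition K5 :: "complex \<Rightarrow> complex \<Rightarrow> complex \<Rightarrow> complex \<Rightarrow> complex" where
  "K5 \<alpha> q p t = (q\<^sup>2 * p\<^sup>2 + \<alpha> * q * p - q) / (2 * t)"

definition I5 :: "complex \<Rightarrow> complex \<Rightarrow> complex \<Rightarrow> complex" where
  "I5 \<alpha> q p = q\<^sup>2 * p\<^sup>2 + \<alpha> * q * p - q"

end

theory Submission
  imports Defs
begin

text \<open>
  The Hamiltonian is \<open>K5 = I5 / (2 t)\<close>: it depends on the time only through a scalar factor.
  Hamilton's equations therefore make the velocity \<open>(q', p')\<close> a scalar multiple of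
  \<open>(\<partial>I5/\<partial>p, - \<partial>I5/\<partial>q)\<close>, which is tangent to the level sets of \<open>I5\<close>. Along a solution, the
  chain rule thus gives \<open>I5\<close> the derivative \<open>0\<close>, and a function whose derivative vanishes on a
  connected open set is constant there.
\<close>

lemma deriv_K5_momentum:
  "deriv (\<lambda>y. K5 \<alpha> q y t) p = (2 * q\<^sup>2 * p + \<alpha> * q) / (2 * t)"
  unfolding K5_def divide_inverse
  by (rule DERIV_imp_deriv) (auto intro!: derivative_eq_intros simp: algebra_simps)

lemma deriv_K5_position:
  "deriv (\<lambda>x. K5 \<alpha> x p t) q = (2 * q * p\<^sup>2 + \<alpha> * p - 1) / (2 * t)"
  unfolding K5_def divide_inverse
  by (rule DERIV_imp_deriv) (auto intro!: derivative_eq_intros simp: algebra_simps)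

lemma has_field_derivative_I5_along_curve:
  assumes "(q has_field_derivative q') (at t)" "(p has_field_derivative p') (at t)"
  shows "((\<lambda>t. I5 \<alpha> (q t) (p t)) has_field_derivative
    (2 * q t * (p t)\<^sup>2 + \<alpha> * p t - 1) * q' + (2 * (q t)\<^sup>2 * p t + \<alpha> * q t) * p') (at t)"
  unfolding I5_def
  by (rule derivative_eq_intros assms refl)+ (simp add: algebra_simps)

theorem proposition4p4:
  fixes \<alpha> :: complex
  shows "first_integral (K5 \<alpha>) (- {0}) (I5 \<alpha>)"
  unfolding first_integral_def
proof (intro allI impI)
  fix D q p
  assume sol: "hamiltonian_solution (K5 \<alpha>) (- {0}) D q p"
  have zero: "((\<lambda>t. I5 \<alpha> (q t) (p t)) has_field_derivative 0) (at t)" if "t \<in> D" for t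
  proof -
    have q': "(q has_field_derivative (2 * (q t)\<^sup>2 * p t + \<alpha> * q t) / (2 * t)) (at t)"
      and p': "(p has_field_derivative - ((2 * q t * (p t)\<^sup>2 + \<alpha> * p t - 1) / (2 * t))) (at t)"
      using sol that
      by (simp_all add: hamiltonian_solution_def deriv_K5_momentum deriv_K5_position)
    show ?thesis
      using has_field_derivative_I5_along_curve[OF q' p', of \<alpha>] by (simp add: mult.commute)
  qed
  have "connected D" "open D"
    using sol by (simp_all add: hamiltonian_solution_def)
  moreover have "continuous_on D (\<lambda>t. I5 \<alpha> (q t) (p t))"
    using zero by (meson DERIV_isCont continuous_at_imp_continuous_on)
  ultimately obtain c where "\<And>t. t \<in> D \<Longrightarrow> I5 \<alpha> (q t) (p t) = c"
    using zero DERIV_zero_connected_constant[of D "{}" "\<lambda>t. I5 \<alpha> (q t) (p t)"] by auto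
  then show "(\<lambda>t. I5 \<alpha> (q t) (p t)) constant_on D"
    unfolding constant_on_def by blast
qed

end
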